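(* Let $N,M$ be finite sets with $z\in M$, $L:=M\setminus z\subset N$ and $N\setminus L=\{x,y\}$, where $x\ne y$. Let $r\in\mathbb{R}^{\mathcal{P}(M)}$ and let $T_{\downarrow\downarrow}(r)\in\mathbb{R}^{\mathcal{P}(N)}$ be its lower replication. (i) One has $m=T_{\downarrow\downarrow}(r)\in\mathcal{K}(N)$ if and only if [$r\in\mathcal{K}(M)$ and $r(z)\ge r(\emptyset)$]. The independency model induced by $m$ is then determined as follows: given $\langle a,b|C\rangle\in\mathcal{E}(N)$, the statement $a\perp b\mid C\ [m]$ is equivalent to - $a\cap L\perp b\cap L\mid C\cap L\ [r]$, in case $\{x,y\}\setminus(a\cup b\cup C)\ne\emptyset$; - $a\perp b\mid z\cup(C\cap L)\ [r]$, in case $\{x,y\}\subseteq C$; - $z\perp\{a,b\}\cap L\mid C\cap L\ [r]$, in case $|\{x,y\}\cap C|=1$ and $\{x,y\}\subseteq a\cup b\cup C$; - $r(z\cup C)=r(C)$, in case $\{x,y\}=\{a,b\}$. (ii) If $r\in\mathcal{K}_\ell(M)$ then $T_{\downarrow\downarrow}(r)\in\mathcal{K}_\ell(N)$. A function $r\in\mathcal{K}_\ell(M)$ is extreme in $\mathcal{K}(M)$ if and only if $T_{\downarrow\downarrow}(r)$ is extreme in $\mathcal{K}(N)$. (iii) If $r$ is extreme in $\mathcal{K}(M)$ and $r(z)=r(\emptyset)$ then $T_{\downarrow\downarrow}(r)$ is extreme in $\mathcal{K}(N)$ and, moreover, $T_{\downarrow\downarrow}(r)\approx T_{\downarrow\downarrow}(r_\ell)$.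 Conversely, if $T_{\downarrow\downarrow}(r)$ is extreme in $\mathcal{K}(N)$ then either [$r$ is extreme in $\mathcal{K}(M)$ and $r(z)=r(\emptyset)$] or one has $r(z)>r(\emptyset)$, $r\in\mathcal{L}(M)$ and $T_{\downarrow\downarrow}(r)\approx[r(z)-r(\emptyset)]\cdot m^{\{x,y\}\subseteq}$.
   Context: $\mathcal{P}(N)$ is the power set of $N$; a singleton $\{a\}$ is written $a$ (so for $a\in N$, $a\cap L$ means $\{a\}\cap L$). $\mathbb{R}^{\mathcal{P}(N)}$ is the space of functions $m:\mathcal{P}(N)\to\mathbb{R}$ with scalar product $\langle m,u\rangle=\sum_{A\subseteq N}m(A)u(A)$. A function $m$ is supermodular if $m(A)+m(B)\le m(A\cup B)+m(A\cap B)$ for all $A,B\subseteq N$, modular if equality always holds; $\mathcal{K}(N)$, $\mathcal{L}(N)$ are the classes of supermodular and modular functions. For $m^1,m^2\in\mathbb{R}^{\mathcal{P}(N)}$, $m^1\approx m^2$ (quantitative equivalence) means $m^1-m^2\in\mathcal{L}(N)$. For $A\subseteq N$, $m^{A\subseteq}(S)=1$ if $A\subseteq S$ and $0$ otherwise. $\mathcal{E}(N)$ is the set of triplets $\langle a,b|C\rangle$ with $a,b\in N$ distinct and $C\subseteq N\setminus\{a,b\}$. For $m\in\mathbb{R}^{\mathcal{P}(N)}$ and pairwise disjoint $A,B,C\subseteq N$, $A\perp B\mid C\ [m]$ means $m(A\cup B\cup C)+m(C)-m(A\cup C)-m(B\cup C)=0$ (trivially true if $A$ or $B$ is empty). The independency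 model induced by $m\in\mathcal{K}(N)$ is the set of $\langle a,b|C\rangle\in\mathcal{E}(N)$ with $a\perp b\mid C\ [m]$. A face of a convex cone $K\subseteq\mathbb{R}^{\mathcal{P}(N)}$ is a set $\{m\in K: k=\langle m,v\rangle\}$, where $v\in\mathbb{R}^{\mathcal{P}(N)}$, $k\in\mathbb{R}$ satisfy $k\le\langle m,v\rangle$ for all $m\in K$. The non-empty faces of $\mathcal{K}(N)$ form a lattice under inclusion with least element $\mathcal{L}(N)$. A function is extreme in $\mathcal{K}(N)$ if it belongs to $\mathcal{K}(N)$ and the smallest face of $\mathcal{K}(N)$ containing it is an atom of this lattice. $\mathcal{K}_\ell(N)=\{m\in\mathcal{K}(N): m(\emptyset)=0,\ m(i)=0\ \forall i\in N\}$, and for $m\in\mathbb{R}^{\mathcal{P}(N)}$ the lower standardization is $m_\ell(T)=m(T)-m(\emptyset)+\sum_{i\in T}[m(\emptyset)-m(i)]$ for $T\subseteq N$. All these definitions are used for other finite sets in place of $N$. The lower replication $T_{\downarrow\downarrow}:\mathbb{R}^{\mathcal{P}(M)}\to\mathbb{R}^{\mathcal{P}(N)}$ is defined, for $S\subseteq N$, by $[T_{\downarrow\downarrow}(r)](S)=r(z\cup(S\cap L))$ if $N\setminus L\subseteq S$, and $[T_{\downarrow\downarrow}(r)](S)=r(S\cap L)$ otherwise. *)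

theory Defs
  imports Complex_Main "HOL-Library.FuncSet"
begin

text \<open>
  The space of real functions on the power set of \<open>N\<close> is rendered by extensional functions, so that
  its elements, and hence sets of them such as faces, carry no information beyond \<open>Pow N\<close>. Vector
  space operations are therefore written with restriction to \<open>Pow N\<close>.
\<close>

definition set_functions :: "'a set \<Rightarrow> ('a set \<Rightarrow> real) set" where
  "set_functions N = Pow N \<rightarrow>\<^sub>E UNIV"

definition scalar_product :: "'a set \<Rightarrow> ('a set \<Rightarrow> real) \<Rightarrow> ('a set \<Rightarrow> real) \<Rightarrow> real" where
  "scalar_product N m u = (\<Sum>A\<in>Pow N. m A * u A)"

definition supermodular_functions :: "'a set \<Rightarrow> ('a set \<Rightarrow> real) set" where
  "supermodular_functions N = {m \<in> set_functions N.
     \<forall>A B. A \<subseteq> N \<longrightarrow> B \<subseteq> N \<longrightarrow> m A + m B \<le> m (A \<union> B) + m (A \<inter> B)}"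

definition modular_functions :: "'a set \<Rightarrow> ('a set \<Rightarrow> real) set" where
  "modular_functions N = {m \<in> set_functions N.
     \<forall>A B. A \<subseteq> N \<longrightarrow> B \<subseteq> N \<longrightarrow> m A + m B = m (A \<union> B) + m (A \<inter> B)}"

definition quant_equiv :: "'a set \<Rightarrow> ('a set \<Rightarrow> real) \<Rightarrow> ('a set \<Rightarrow> real) \<Rightarrow> bool" where
  "quant_equiv N m1 m2 \<longleftrightarrow> (\<lambda>S\<in>Pow N. m1 S - m2 S) \<in> modular_functions N"

definition superset_indicator :: "'a set \<Rightarrow> 'a set \<Rightarrow> 'a set \<Rightarrow> real" where
  "superset_indicator N A = (\<lambda>S\<in>Pow N. if A \<subseteq> S then 1 else 0)"

definition triplets :: "'a set \<Rightarrow> ('a \<times> 'a \<times> 'a set) set" where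
  "triplets N = {(a, b, C). a \<in> N \<and> b \<in> N \<and> a \<noteq> b \<and> C \<subseteq> N - {a, b}}"

text \<open>Meant for pairwise disjoint \<open>A\<close>, \<open>B\<close>, \<open>C\<close> within the ground set of \<open>m\<close>.\<close>

definition cond_indep :: "('a set \<Rightarrow> real) \<Rightarrow> 'a set \<Rightarrow> 'a set \<Rightarrow> 'a set \<Rightarrow> bool" where
  "cond_indep m A B C \<longleftrightarrow> m (A \<union> B \<union> C) + m C - m (A \<union> C) - m (B \<union> C) = 0"

definition induced_model :: "'a set \<Rightarrow> ('a set \<Rightarrow> real) \<Rightarrow> ('a \<times> 'a \<times> 'a set) set" where
  "induced_model N m = {(a, b, C) \<in> triplets N. cond_indep m {a} {b} C}"

definition faces :: "'a set \<Rightarrow> ('a set \<Rightarrow> real) set \<Rightarrow> ('a set \<Rightarrow> real) set set" where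
  "faces N K = {{m \<in> K. k = scalar_product N m v} | v k.
     v \<in> set_functions N \<and> (\<forall>m\<in>K. k \<le> scalar_product N m v)}"

definition nonempty_faces :: "'a set \<Rightarrow> ('a set \<Rightarrow> real) set set" where
  "nonempty_faces N = {F \<in> faces N (supermodular_functions N). F \<noteq> {}}"

text \<open>The least non-empty face of the supermodular cone is the set of modular functions.\<close>

definition atomic_face :: "'a set \<Rightarrow> ('a set \<Rightarrow> real) set \<Rightarrow> bool" where
  "atomic_face N F \<longleftrightarrow> F \<in> nonempty_faces N \<and> F \<noteq> modular_functions N \<and>
     (\<forall>G\<in>nonempty_faces N. G \<subseteq> F \<longrightarrow> G = modular_functions N \<or> G = F)"

definition smallest_face_containing ::
    "'a set \<Rightarrow> ('a set \<Rightarrow> real) \<Rightarrow> ('a set \<Rightarrow> real) set \<Rightarrow> bool" where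
  "smallest_face_containing N m F \<longleftrightarrow>
     F \<in> faces N (supermodular_functions N) \<and> m \<in> F \<and>
     (\<forall>G\<in>faces N (supermodular_functions N). m \<in> G \<longrightarrow> F \<subseteq> G)"

definition extreme :: "'a set \<Rightarrow> ('a set \<Rightarrow> real) \<Rightarrow> bool" where
  "extreme N m \<longleftrightarrow> m \<in> supermodular_functions N \<and>
     (\<exists>F. smallest_face_containing N m F \<and> atomic_face N F)"

definition lower_standardized :: "'a set \<Rightarrow> ('a set \<Rightarrow> real) set" where
  "lower_standardized N = {m \<in> supermodular_functions N. m {} = 0 \<and> (\<forall>i\<in>N. m {i} = 0)}"

definition lower_standardization :: "'a set \<Rightarrow> ('a set \<Rightarrow> real) \<Rightarrow> 'a set \<Rightarrow> real" where
  "lower_standardization N m = (\<lambda>T\<in>Pow N. m T - m {} + (\<Sum>i\<in>T. m {} - m {i}))"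

definition lower_replication ::
    "'a set \<Rightarrow> 'a set \<Rightarrow> 'a \<Rightarrow> ('a set \<Rightarrow> real) \<Rightarrow> 'a set \<Rightarrow> real" where
  "lower_replication N L z r =
     (\<lambda>S\<in>Pow N. if N - L \<subseteq> S then r ({z} \<union> (S \<inter> L)) else r (S \<inter> L))"

end

(* The smallest face of the supermodular cone containing m consists of the supermodular functions
   satisfying with equality every supermodularity inequality that is tight for m. Hence extremality
   is a statement about sets of tight inequalities only. If r(z) = r(empty), these sets for r and
   for its replication determine each other, and, up to adding modular functions, every member of
   the face of the replication is itself a replication. If r(z) > r(empty), the replication is a sum of a
   supermodular function and a positive multiple of the indicator of the supersets of {x, y}, so
   extremality forces the first summand to be modular. *)

theory Submission
  imports Defs
begin

section \<open>Extremality in terms of tight inequalities\<close>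

definition defect :: "('a set \<Rightarrow> real) \<Rightarrow> 'a set \<Rightarrow> 'a set \<Rightarrow> real" where
  "defect m A B = m (A \<union> B) + m (A \<inter> B) - m A - m B"

text \<open>A preorder standing in for inclusion of smallest faces: once it holds from
  \<open>m\<close> to \<open>u\<close>, \<open>tight_face N u\<close> lies inside
  \<open>tight_face N m\<close>.\<close>

definition inherits_tightness :: "'a set \<Rightarrow> ('a set \<Rightarrow> real) \<Rightarrow> ('a set \<Rightarrow> real) \<Rightarrow> bool" where
  "inherits_tightness N m u \<longleftrightarrow>
     (\<forall>A B. A \<subseteq> N \<longrightarrow> B \<subseteq> N \<longrightarrow> defect m A B = 0 \<longrightarrow> defect u A B = 0)"

definition tight_face :: "'a set \<Rightarrow> ('a set \<Rightarrow> real) \<Rightarrow> ('a set \<Rightarrow> real) set" where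
  "tight_face N m = {u \<in> supermodular_functions N. inherits_tightness N m u}"

lemma supermodular_iff_defect:
  "m \<in> supermodular_functions N \<longleftrightarrow>
     m \<in> set_functions N \<and> (\<forall>A B. A \<subseteq> N \<longrightarrow> B \<subseteq> N \<longrightarrow> 0 \<le> defect m A B)"
proof -
  have "m A + m B \<le> m (A \<union> B) + m (A \<inter> B) \<longleftrightarrow> 0 \<le> defect m A B" for A B
    by (auto simp: defect_def)
  then show ?thesis by (simp add: supermodular_functions_def)
qed

lemma modular_iff_defect:
  "m \<in> modular_functions N \<longleftrightarrow>
     m \<in> set_functions N \<and> (\<forall>A B. A \<subseteq> N \<longrightarrow> B \<subseteq> N \<longrightarrow> defect m A B = 0)"
proof -
  have "m A + m B = m (A \<union> B) + m (A \<inter> B) \<longleftrightarrow> defect m A B = 0" for A B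
    by (auto simp: defect_def)
  then show ?thesis by (simp add: modular_functions_def)
qed

lemma restrict_in_set_functions [simp]: "(\<lambda>S\<in>Pow N. f S) \<in> set_functions N"
  by (simp add: set_functions_def)

lemma set_functions_eqI:
  "f \<in> set_functions N \<Longrightarrow> g \<in> set_functions N \<Longrightarrow> (\<And>S. S \<subseteq> N \<Longrightarrow> f S = g S) \<Longrightarrow> f = g"
  unfolding set_functions_def by (rule PiE_ext) auto

lemma defect_restrict:
  assumes "A \<subseteq> N" "B \<subseteq> N"
  shows "defect (\<lambda>S\<in>Pow N. f S) A B = defect f A B"
proof -
  have "A \<union> B \<subseteq> N" "A \<inter> B \<subseteq> N" using assms by auto
  then show ?thesis using assms by (simp add: defect_def)
qed

lemma defect_diff: "defect (\<lambda>S. f S - g S) A B = defect f A B - defect g A B"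
  and defect_scale: "defect (\<lambda>S. c * f S) A B = c * defect f A B"
  by (simp_all add: defect_def algebra_simps)

lemma defect_sum:
  fixes w :: "'a \<Rightarrow> real"
  assumes "finite A" "finite B"
  shows "defect (sum w) A B = 0"
  using sum.union_inter[OF assms, of w] by (simp add: defect_def)

lemma modular_subset_tight_face: "modular_functions N \<subseteq> tight_face N m"
  by (auto simp: tight_face_def modular_iff_defect supermodular_iff_defect inherits_tightness_def)

section \<open>Smallest faces of the supermodular cone\<close>

lemma scalar_product_diff_scaled:
  "scalar_product N (\<lambda>S\<in>Pow N. m S - c * u S) v = scalar_product N m v - c * scalar_product N u v"
  by (simp add: scalar_product_def sum_subtractf sum_distrib_left left_diff_distrib mult.assoc)

text \<open>The vector is a sum of indicators rather than a case distinction because the four sets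
  may coincide, in which case their contributions add up or cancel.\<close>

lemma defect_as_scalar_product:
  assumes "finite N" "A \<subseteq> N" "B \<subseteq> N"
  shows "scalar_product N m (\<lambda>S. of_bool (S = A \<union> B) + of_bool (S = A \<inter> B)
           - of_bool (S = A) - of_bool (S = B)) = defect m A B"
proof -
  have pick: "(\<Sum>S\<in>Pow N. m S * of_bool (S = T)) = m T" if "T \<subseteq> N" for T
    using that \<open>finite N\<close> by (simp add: of_bool_def if_distrib cong: if_cong)
  have "A \<union> B \<subseteq> N" "A \<inter> B \<subseteq> N" using assms by auto
  then show ?thesis
    using assms unfolding scalar_product_def distrib_left right_diff_distrib sum_subtractf sum.distrib
    by (simp only: pick defect_def)
qed

text \<open>The exposing functional is the sum of all defects that vanish at \<open>m\<close>. On
  the supermodular cone every summand is nonnegative, so the sum equals 0 exactly where all of them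
  vanish.\<close>

lemma tight_face_is_face:
  assumes "finite N"
  shows "tight_face N m \<in> faces N (supermodular_functions N)"
proof -
  define P where "P = {(A, B). A \<subseteq> N \<and> B \<subseteq> N \<and> defect m A B = 0}"
  have "P \<subseteq> Pow N \<times> Pow N" by (auto simp: P_def)
  then have finP: "finite P" using assms finite_subset by blast
  define e :: "'a set \<times> 'a set \<Rightarrow> 'a set \<Rightarrow> real" where "e = (\<lambda>(A, B) S.
      of_bool (S = A \<union> B) + of_bool (S = A \<inter> B) - of_bool (S = A) - of_bool (S = B))"
  define v where "v = (\<lambda>S\<in>Pow N. \<Sum>p\<in>P. e p S)"
  have sp: "scalar_product N u v = (\<Sum>(A, B)\<in>P. defect u A B)" for u
  proof -
    have "scalar_product N u v = (\<Sum>S\<in>Pow N. \<Sum>p\<in>P. u S * e p S)"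
      by (simp add: scalar_product_def v_def sum_distrib_left)
    also have "\<dots> = (\<Sum>p\<in>P. scalar_product N u (e p))"
      unfolding scalar_product_def by (rule sum.swap)
    also have "\<dots> = (\<Sum>(A, B)\<in>P. defect u A B)"
      using defect_as_scalar_product[OF assms]
      by (intro sum.cong) (auto simp: P_def e_def)
    finally show ?thesis .
  qed
  have nonneg: "0 \<le> (case p of (A, B) \<Rightarrow> defect u A B)"
    if "u \<in> supermodular_functions N" "p \<in> P" for u p
    using that by (auto simp: supermodular_iff_defect P_def)
  have "0 \<le> scalar_product N u v" if "u \<in> supermodular_functions N" for u
    unfolding sp by (rule sum_nonneg) (rule nonneg[OF that])
  moreover have "0 = scalar_product N u v \<longleftrightarrow> inherits_tightness N m u"
    if "u \<in> supermodular_functions N" for u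
    using sum_nonneg_eq_0_iff[OF finP nonneg[OF that]]
    unfolding sp inherits_tightness_def P_def by auto
  then have "tight_face N m = {u \<in> supermodular_functions N. 0 = scalar_product N u v}"
    unfolding tight_face_def by auto
  moreover have "v \<in> set_functions N" by (simp add: v_def)
  ultimately show ?thesis unfolding faces_def by blast
qed

text \<open>Wherever \<open>g\<close> is positive so is \<open>f\<close>, hence the finitely many
  ratios \<open>f p / g p\<close> have a positive lower bound. Applied to defects, this keeps
  \<open>m\<close> minus a small multiple of \<open>u\<close> supermodular.\<close>

lemma ex_pos_scaling_below:
  fixes f g :: "'b \<Rightarrow> real"
  assumes "finite D" "\<And>p. p \<in> D \<Longrightarrow> 0 \<le> f p" "\<And>p. p \<in> D \<Longrightarrow> 0 \<le> g p"
    and "\<And>p. p \<in> D \<Longrightarrow> f p = 0 \<Longrightarrow> g p = 0"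
  shows "\<exists>\<epsilon>>0. \<forall>p\<in>D. \<epsilon> * g p \<le> f p"
  using assms
proof (induction D rule: finite_induct)
  case empty
  show ?case by (auto intro: exI[of _ 1])
next
  case (insert q D)
  then obtain \<epsilon> where \<epsilon>: "\<epsilon> > 0" "\<forall>p\<in>D. \<epsilon> * g p \<le> f p" by auto
  obtain \<delta> where \<delta>: "\<delta> > 0" "\<delta> * g q \<le> f q"
  proof (cases "g q = 0")
    case True
    then show ?thesis using that[of 1] insert.prems(1)[of q] by simp
  next
    case False
    moreover have "0 < f q" "0 < g q"
      using False insert.prems(1)[of q] insert.prems(2)[of q] insert.prems(3)[of q] by force+
    ultimately show ?thesis using that[of "f q / g q"] by simp
  qed
  have "min \<epsilon> \<delta> * g p \<le> f p" if "p \<in> insert q D" for p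
  proof (cases "p = q")
    case True
    then have "min \<epsilon> \<delta> * g p \<le> \<delta> * g p" using insert.prems(2) by (intro mult_right_mono) auto
    then show ?thesis using \<delta> True by simp
  next
    case False
    have "min \<epsilon> \<delta> * g p \<le> \<epsilon> * g p" using insert.prems(2) that by (intro mult_right_mono) auto
    then show ?thesis using \<epsilon> that False by fastforce
  qed
  then show ?case using \<epsilon> \<delta> by (intro exI[of _ "min \<epsilon> \<delta>"]) auto
qed

text \<open>In convex terms, \<open>m\<close> lies in the relative interior of its tight face, so a
  face through \<open>m\<close> contains all of it.\<close>

lemma tight_face_subset_face:
  assumes "finite N" and G: "G \<in> faces N (supermodular_functions N)" and "m \<in> G"
  shows "tight_face N m \<subseteq> G"
proof
  fix u assume "u \<in> tight_face N m"
  then have u: "u \<in> supermodular_functions N" and mu: "inherits_tightness N m u"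
    by (auto simp: tight_face_def)
  obtain v k where Geq: "G = {w \<in> supermodular_functions N. k = scalar_product N w v}"
    and k: "\<And>w. w \<in> supermodular_functions N \<Longrightarrow> k \<le> scalar_product N w v"
    using G unfolding faces_def by blast
  have m: "m \<in> supermodular_functions N" and mk: "scalar_product N m v = k"
    using \<open>m \<in> G\<close> Geq by auto
  \<comment> \<open>Evaluating the face inequality at \<open>m - c w\<close>: \<open>w = m\<close> with \<open>c = \<plusminus>1\<close> gives \<open>k = 0\<close>, and \<open>w = u\<close>
     with a small \<open>c > 0\<close> forces \<open>u\<close> onto the face.\<close>
  have comb: "k \<le> k - c * scalar_product N w v"
    if "w \<in> set_functions N" "\<And>A B. A \<subseteq> N \<Longrightarrow> B \<subseteq> N \<Longrightarrow> c * defect w A B \<le> defect m A B" for w c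
  proof -
    have "(\<lambda>S\<in>Pow N. m S - c * w S) \<in> supermodular_functions N"
      using that by (simp add: supermodular_iff_defect defect_restrict defect_diff defect_scale)
    from k[OF this] show ?thesis by (simp add: scalar_product_diff_scaled mk)
  qed
  have m_def: "m \<in> set_functions N" "\<And>A B. A \<subseteq> N \<Longrightarrow> B \<subseteq> N \<Longrightarrow> 0 \<le> defect m A B"
    and u_def: "u \<in> set_functions N" "\<And>A B. A \<subseteq> N \<Longrightarrow> B \<subseteq> N \<Longrightarrow> 0 \<le> defect u A B"
    using m u by (auto simp: supermodular_iff_defect)
  have "k \<le> k - 1 * scalar_product N m v" by (rule comb) (use m_def in auto)
  moreover have "k \<le> k - (-1) * scalar_product N m v" by (rule comb) (use m_def in force)+
  ultimately have k0: "k = 0" using mk by simp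
  have "finite (Pow N \<times> Pow N)" using \<open>finite N\<close> by simp
  then have "\<exists>\<epsilon>>0. \<forall>p\<in>Pow N \<times> Pow N. \<epsilon> * (case p of (A, B) \<Rightarrow> defect u A B) \<le>
      (case p of (A, B) \<Rightarrow> defect m A B)"
    by (rule ex_pos_scaling_below) (use m_def u_def mu in \<open>auto simp: inherits_tightness_def\<close>)
  then obtain \<epsilon> where \<epsilon>: "\<epsilon> > 0"
    and le: "\<And>A B. A \<subseteq> N \<Longrightarrow> B \<subseteq> N \<Longrightarrow> \<epsilon> * defect u A B \<le> defect m A B"
    by auto
  have "\<epsilon> * scalar_product N u v \<le> 0" using comb[OF u_def(1) le] by simp
  then have "scalar_product N u v \<le> 0" using \<epsilon> by (simp add: mult_le_0_iff)
  then show "u \<in> G" using k[OF u] k0 u by (auto simp: Geq)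
qed

lemma smallest_face_containing_iff:
  assumes "finite N" "m \<in> supermodular_functions N"
  shows "smallest_face_containing N m F \<longleftrightarrow> F = tight_face N m"
proof -
  have "m \<in> tight_face N m" using assms by (simp add: tight_face_def inherits_tightness_def)
  then show ?thesis
    unfolding smallest_face_containing_def
    using tight_face_is_face[OF assms(1), of m] tight_face_subset_face[OF assms(1)] by blast
qed

section \<open>Extremality expressed without faces\<close>

lemma tight_face_mono:
  "inherits_tightness N m u \<Longrightarrow> tight_face N u \<subseteq> tight_face N m"
  by (auto simp: tight_face_def inherits_tightness_def)

text \<open>A non-empty face contains the tight face of each of its members, so whether a face is an
  atom can be tested on tight faces of single functions, and these depend only on sets of tight
  pairs.\<close>

lemma extreme_iff_tightness:
  assumes "finite N"
  shows "extreme N m \<longleftrightarrow> m \<in> supermodular_functions N \<and> m \<notin> modular_functions N \<and>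
    (\<forall>u\<in>supermodular_functions N. inherits_tightness N m u \<longrightarrow>
       u \<in> modular_functions N \<or> inherits_tightness N u m)"
proof (cases "m \<in> supermodular_functions N")
  case False
  then show ?thesis by (simp add: extreme_def)
next
  case m: True
  have self: "u \<in> tight_face N u" if "u \<in> supermodular_functions N" for u
    using that by (simp add: tight_face_def inherits_tightness_def)
  have sub: "tight_face N u \<subseteq> G" if "G \<in> nonempty_faces N" "u \<in> G" for u G
    using that tight_face_subset_face[OF assms] by (simp add: nonempty_faces_def)
  have face: "tight_face N u \<in> nonempty_faces N" if "u \<in> supermodular_functions N" for u
    using self[OF that] tight_face_is_face[OF assms, of u] by (auto simp: nonempty_faces_def)
  have face_super: "G \<subseteq> supermodular_functions N" if "G \<in> nonempty_faces N" for G
    using that by (auto simp: nonempty_faces_def faces_def)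
  have mod: "tight_face N u = modular_functions N \<longleftrightarrow> u \<in> modular_functions N"
    if "u \<in> supermodular_functions N" for u
  proof
    show "u \<in> modular_functions N" if "tight_face N u = modular_functions N"
      using self[OF \<open>u \<in> supermodular_functions N\<close>] that by simp
  next
    assume "u \<in> modular_functions N"
    then have "tight_face N u \<subseteq> modular_functions N"
      by (auto simp: tight_face_def modular_iff_defect supermodular_iff_defect
          inherits_tightness_def)
    then show "tight_face N u = modular_functions N" using modular_subset_tight_face by blast
  qed
  have "extreme N m \<longleftrightarrow> atomic_face N (tight_face N m)"
    using smallest_face_containing_iff[OF assms m] m by (simp add: extreme_def)
  also have "\<dots> \<longleftrightarrow> m \<notin> modular_functions N \<and>
    (\<forall>G\<in>nonempty_faces N. G \<subseteq> tight_face N m \<longrightarrow>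
       G = modular_functions N \<or> G = tight_face N m)"
    using mod[OF m] face[OF m] by (simp add: atomic_face_def)
  also have "(\<forall>G\<in>nonempty_faces N. G \<subseteq> tight_face N m \<longrightarrow>
       G = modular_functions N \<or> G = tight_face N m) \<longleftrightarrow>
    (\<forall>u\<in>supermodular_functions N. inherits_tightness N m u \<longrightarrow>
       u \<in> modular_functions N \<or> inherits_tightness N u m)" (is "?faces \<longleftrightarrow> ?tight")
  proof
    assume faces: ?faces
    show ?tight
    proof (intro ballI impI)
      fix u assume u: "u \<in> supermodular_functions N" and mu: "inherits_tightness N m u"
      from faces[rule_format, OF face[OF u] tight_face_mono[OF mu]]
      show "u \<in> modular_functions N \<or> inherits_tightness N u m"
      proof
        assume "tight_face N u = tight_face N m"
        then have "m \<in> tight_face N u" using self[OF m] by simp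
        then show ?thesis by (simp add: tight_face_def)
      qed (simp add: mod[OF u])
    qed
  next
    assume tight: ?tight
    show ?faces
    proof (intro ballI impI)
      fix G assume G: "G \<in> nonempty_faces N" and Gm: "G \<subseteq> tight_face N m"
      show "G = modular_functions N \<or> G = tight_face N m"
      \<comment> \<open>Any member of \<open>G\<close> already forces all modular functions into
        \<open>G\<close>. A non-modular member \<open>u\<close> gives more: its tight face lies in
        \<open>G\<close> and, by the hypothesis, contains that of \<open>m\<close>.\<close>
      proof (cases "G \<subseteq> modular_functions N")
        case True
        obtain u where "u \<in> G" using G by (auto simp: nonempty_faces_def)
        then have "modular_functions N \<subseteq> G"
          using sub[OF G] modular_subset_tight_face by blast
        then show ?thesis using True by blast
      next
        case False
        then obtain u where u: "u \<in> G" "u \<notin> modular_functions N" by blast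
        then have "u \<in> tight_face N m" using Gm by blast
        then have "inherits_tightness N u m"
          using tight[rule_format, of u] u(2) by (simp add: tight_face_def)
        then have "tight_face N m \<subseteq> G" using tight_face_mono sub[OF G u(1)] by (meson subset_trans)
        then show ?thesis using Gm by simp
      qed
    qed
  qed
  finally show ?thesis using m by simp
qed

section \<open>Lower replication\<close>

text \<open>The element \<open>z\<close> may coincide with \<open>x\<close> or \<open>y\<close>;
  subsets of \<open>M\<close> and of \<open>N\<close> are matched through the maps
  \<open>lift\<close> and \<open>proj\<close>.\<close>

locale replication =
  fixes N M L :: "'a set" and x y z :: 'a
  assumes finite_N: "finite N" and finite_M: "finite M"
    and z_in: "z \<in> M" and L_eq: "L = M - {z}" and L_sub: "L \<subset> N"
    and N_diff: "N - L = {x, y}" and x_neq_y: "x \<noteq> y"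
begin

section \<open>Passing between subsets of \<open>M\<close> and subsets of \<open>N\<close>\<close>

abbreviation rep :: "('a set \<Rightarrow> real) \<Rightarrow> 'a set \<Rightarrow> real" where
  "rep \<equiv> lower_replication N L z"

text \<open>Substituting the pair \<open>x\<close>, \<open>y\<close> for \<open>z\<close> embeds the
  subsets of \<open>M\<close> as a sublattice of the subsets of \<open>N\<close>.\<close>

definition lift :: "'a set \<Rightarrow> 'a set" where
  "lift A = (A \<inter> L) \<union> (if z \<in> A then {x, y} else {})"

text \<open>Replication is composition with this left inverse of \<open>lift\<close>. It respects
  intersections but not all unions, since \<open>z\<close> is produced only by \<open>x\<close> and
  \<open>y\<close> jointly.\<close>

definition proj :: "'a set \<Rightarrow> 'a set" where
  "proj S = (S \<inter> L) \<union> (if {x, y} \<subseteq> S then {z} else {})"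

lemma notin_L [simp]: "x \<notin> L" "y \<notin> L" "z \<notin> L"
  using N_diff L_eq by auto

lemma xy_in_N [simp]: "x \<in> N" "y \<in> N"
  using N_diff by auto

lemma N_eq: "N = L \<union> {x, y}" and M_eq: "M = insert z L"
  using N_diff L_sub L_eq z_in by auto

lemma lift_Un: "lift (A \<union> B) = lift A \<union> lift B"
  and lift_Int: "lift (A \<inter> B) = lift A \<inter> lift B"
  by (auto simp: lift_def)

lemma lift_subset: "lift A \<subseteq> N"
  by (auto simp: lift_def N_eq)

lemma proj_subset: "proj S \<subseteq> M"
  by (auto simp: proj_def M_eq)

lemma proj_lift: "A \<subseteq> M \<Longrightarrow> proj (lift A) = A"
  by (auto simp: proj_def lift_def M_eq)

lemma proj_Int: "proj (A \<inter> B) = proj A \<inter> proj B"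
  by (auto simp: proj_def)

text \<open>The exceptional case is that one of \<open>x\<close>, \<open>y\<close> comes from
  \<open>A\<close> and the other from \<open>B\<close>: then \<open>z\<close> arises only in the
  projection of the union.\<close>

lemma proj_Un_cases:
  obtains "proj (A \<union> B) = proj A \<union> proj B"
  | "proj (A \<union> B) = insert z ((A \<union> B) \<inter> L)" "proj A = A \<inter> L" "proj B = B \<inter> L"
proof (cases "{x, y} \<subseteq> A \<or> {x, y} \<subseteq> B \<or> \<not> {x, y} \<subseteq> A \<union> B")
  case True
  then have "proj (A \<union> B) = proj A \<union> proj B" by (auto simp: proj_def)
  then show ?thesis by (rule that(1))
next
  case False
  then show ?thesis by (intro that(2)) (auto simp: proj_def)
qed

lemma rep_eq_proj: "S \<subseteq> N \<Longrightarrow> rep r S = r (proj S)"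
  by (simp add: lower_replication_def proj_def N_diff)

lemma rep_lift: "A \<subseteq> M \<Longrightarrow> rep r (lift A) = r A"
  by (simp add: rep_eq_proj lift_subset proj_lift)

lemma rep_in_set_functions [simp]: "rep r \<in> set_functions N"
  by (simp add: lower_replication_def)

lemma defect_rep_lift:
  assumes "A \<subseteq> M" "B \<subseteq> M"
  shows "defect (rep r) (lift A) (lift B) = defect r A B"
proof -
  have "A \<union> B \<subseteq> M" "A \<inter> B \<subseteq> M" using assms by auto
  then show ?thesis
    using assms by (simp add: defect_def rep_lift flip: lift_Un lift_Int)
qed

text \<open>The extra summand is the increment \<open>r (C \<union> {z}) - r C\<close>; it appears when \<open>x\<close> and \<open>y\<close> both lie
  in \<open>A \<union> B\<close> but neither \<open>A\<close> nor \<open>B\<close> contains both.\<close>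

lemma defect_rep_cases:
  assumes "A \<subseteq> N" "B \<subseteq> N"
  obtains "\<And>r. defect (rep r) A B = defect r (proj A) (proj B)"
  | C where "C \<subseteq> L"
      "\<And>r. defect (rep r) A B = defect r (proj A) (proj B) + (defect r C {z} + (r {z} - r {}))"
proof -
  have sub: "A \<union> B \<subseteq> N" "A \<inter> B \<subseteq> N" using assms by auto
  show ?thesis
  proof (cases A B rule: proj_Un_cases)
    case 1
    then have "defect (rep r) A B = defect r (proj A) (proj B)" for r
      using assms sub by (simp add: defect_def rep_eq_proj proj_Int)
    then show ?thesis by (rule that(1))
  next
    case 2
    have un: "proj A \<union> proj B = (A \<union> B) \<inter> L" using 2 by auto
    have int: "(A \<union> B) \<inter> L \<inter> {z} = {}" and ins: "(A \<union> B) \<inter> L \<union> {z} = proj (A \<union> B)"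
      using 2(1) by auto
    \<comment> \<open>Here \<open>C\<close> is the part of the union inside \<open>L\<close>.
      Splitting its increment into a defect against \<open>{z}\<close> and
      \<open>r {z} - r {}\<close> yields terms that are each nonnegative when \<open>r\<close> is
      supermodular and \<open>r {z} \<ge> r {}\<close>.\<close>
    have "defect (rep r) A B = defect r (proj A) (proj B)
        + (defect r ((A \<union> B) \<inter> L) {z} + (r {z} - r {}))" for r
      unfolding defect_def un int ins using assms sub by (simp add: rep_eq_proj proj_Int)
    then show ?thesis by (intro that(2)) auto
  qed
qed

section \<open>Supermodularity, tightness and modularity under replication\<close>

lemma supermodular_rep_iff:
  assumes "r \<in> set_functions M"
  shows "rep r \<in> supermodular_functions N \<longleftrightarrow> r \<in> supermodular_functions M \<and> r {z} \<ge> r {}"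
proof
  assume L: "rep r \<in> supermodular_functions N"
  then have "0 \<le> defect r A B" if "A \<subseteq> M" "B \<subseteq> M" for A B
    using defect_rep_lift[OF that, of r] lift_subset by (metis supermodular_iff_defect)
  \<comment> \<open>The defect at this pair is exactly \<open>r {z} - r {}\<close>, as both
    singletons project to the empty set.\<close>
  moreover have "0 \<le> defect (rep r) {x} {y}" using L by (simp add: supermodular_iff_defect)
  then have "r {} \<le> r {z}"
    using x_neq_y by (simp add: defect_def rep_eq_proj proj_def insert_commute)
  ultimately show "r \<in> supermodular_functions M \<and> r {z} \<ge> r {}"
    using assms by (simp add: supermodular_iff_defect)
next
  assume R: "r \<in> supermodular_functions M \<and> r {z} \<ge> r {}"
  then have r: "0 \<le> defect r A B" if "A \<subseteq> M" "B \<subseteq> M" for A B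
    using that by (simp add: supermodular_iff_defect)
  have "0 \<le> defect (rep r) A B" if AB: "A \<subseteq> N" "B \<subseteq> N" for A B
  proof (cases rule: defect_rep_cases[OF AB])
    case 1
    then show ?thesis using r proj_subset by simp
  next
    case (2 C)
    then have "0 \<le> defect r C {z}" by (intro r) (auto simp: M_eq)
    then show ?thesis using 2 r[OF proj_subset proj_subset, of A B] R by simp
  qed
  then show "rep r \<in> supermodular_functions N" by (simp add: supermodular_iff_defect)
qed

text \<open>With \<open>r {z} = r {}\<close>, a defect of \<open>rep r\<close> is one defect of
  \<open>r\<close> or a sum of two. As these are nonnegative, a vanishing sum makes each term
  vanish, and tightness passes to \<open>s\<close> term by term.\<close>

lemma inherits_tightness_rep_iff:
  assumes "r \<in> supermodular_functions M" "r {z} = r {}" "s {z} = s {}"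
  shows "inherits_tightness N (rep r) (rep s) \<longleftrightarrow> inherits_tightness M r s"
proof
  assume "inherits_tightness N (rep r) (rep s)"
  then show "inherits_tightness M r s"
    unfolding inherits_tightness_def by (metis defect_rep_lift lift_subset)
next
  assume rs: "inherits_tightness M r s"
  have r: "0 \<le> defect r A B" if "A \<subseteq> M" "B \<subseteq> M" for A B
    using assms that by (simp add: supermodular_iff_defect)
  show "inherits_tightness N (rep r) (rep s)"
    unfolding inherits_tightness_def
  proof (intro allI impI)
    fix A B assume AB: "A \<subseteq> N" "B \<subseteq> N" and 0: "defect (rep r) A B = 0"
    note tight = rs[unfolded inherits_tightness_def, rule_format]
    show "defect (rep s) A B = 0"
    proof (cases rule: defect_rep_cases[OF AB])
      case 1
      then show ?thesis using 0 tight proj_subset by simp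
    next
      case (2 C)
      have CM: "C \<subseteq> M" "{z} \<subseteq> M" using 2(1) by (auto simp: M_eq)
      show ?thesis
        using 0 r[OF CM] r[OF proj_subset proj_subset, of A B] CM
        by (simp add: 2(2) assms(2,3) add_nonneg_eq_0_iff tight proj_subset)
    qed
  qed
qed

lemma modular_rep_iff:
  assumes "r \<in> set_functions M"
  shows "rep r \<in> modular_functions N \<longleftrightarrow> r \<in> modular_functions M \<and> r {z} = r {}"
proof
  assume L: "rep r \<in> modular_functions N"
  then have "defect r A B = 0" if "A \<subseteq> M" "B \<subseteq> M" for A B
    using defect_rep_lift[OF that, of r] lift_subset by (metis modular_iff_defect)
  moreover have "defect (rep r) {x} {y} = 0" using L by (simp add: modular_iff_defect)
  then have "r {} = r {z}"
    using x_neq_y by (simp add: defect_def rep_eq_proj proj_def insert_commute)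
  ultimately show "r \<in> modular_functions M \<and> r {z} = r {}"
    using assms by (simp add: modular_iff_defect)
next
  assume R: "r \<in> modular_functions M \<and> r {z} = r {}"
  then have r: "defect r A B = 0" if "A \<subseteq> M" "B \<subseteq> M" for A B
    using that by (simp add: modular_iff_defect)
  have "defect (rep r) A B = 0" if AB: "A \<subseteq> N" "B \<subseteq> N" for A B
  proof (cases rule: defect_rep_cases[OF AB])
    case 1
    then show ?thesis using r proj_subset by simp
  next
    case (2 C)
    then have "defect r C {z} = 0" by (intro r) (auto simp: M_eq)
    then show ?thesis using 2 r[OF proj_subset proj_subset, of A B] R by simp
  qed
  then show "rep r \<in> modular_functions N" by (simp add: modular_iff_defect)
qed

section \<open>Extremality of replications\<close>

text \<open>Subtracting the modular function \<open>sum w\<close> normalizes \<open>u\<close> so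
  that a lone \<open>x\<close> or \<open>y\<close> has no effect; what remains is the replication of
  its own pullback along \<open>lift\<close>.\<close>

lemma replication_up_to_modular:
  assumes tight: "inherits_tightness N (rep r) u" and rz: "r {z} = r {}"
  obtains s where "s \<in> set_functions M" "s {z} = s {}"
    "\<And>A B. A \<subseteq> N \<Longrightarrow> B \<subseteq> N \<Longrightarrow> defect (rep s) A B = defect u A B"
proof -
  define w where "w = (\<lambda>i. if i \<in> {x, y} then u {i} - u {} else 0)"
  define u' where "u' = (\<lambda>S. u S - sum w S)"
  define s where "s = (\<lambda>A\<in>Pow M. u' (lift A))"
  have sum_w: "sum w C = 0" if "C \<subseteq> L" for C
    using that by (intro sum.neutral) (auto simp: w_def)
  have fin: "finite C" if "C \<subseteq> N" for C
    using that finite_N finite_subset by blast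
  \<comment> \<open>The pair \<open>{t}\<close>, \<open>C\<close> is tight for \<open>rep r\<close>,
    because adding one of \<open>x\<close>, \<open>y\<close> to a subset of \<open>L\<close> leaves
    the projection unchanged. As \<open>u\<close> inherits this, its increment at \<open>t\<close>
    does not depend on \<open>C\<close> and equals \<open>w t\<close>.\<close>
  have drop: "u' (insert t C) = u' C" if "C \<subseteq> L" "t \<in> {x, y}" for C t
  proof -
    have "t \<in> N" "C \<subseteq> N" "t \<notin> C" using that by (auto simp: N_eq)
    moreover have "proj (insert t C) = C" "proj C = C" "proj {t} = {}" "proj {} = {}"
      using that x_neq_y by (auto simp: proj_def)
    ultimately have "defect (rep r) {t} C = 0" by (simp add: defect_def rep_eq_proj)
    then have "defect u {t} C = 0"
      using tight \<open>t \<in> N\<close> \<open>C \<subseteq> N\<close> by (simp add: inherits_tightness_def)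
    moreover have "sum w (insert t C) = w t"
      using \<open>t \<notin> C\<close> fin[OF \<open>C \<subseteq> N\<close>] sum_w[OF that(1)] by simp
    moreover have "w t = u {t} - u {}" using that by (simp add: w_def)
    ultimately show ?thesis
      using \<open>t \<notin> C\<close> sum_w[OF that(1)] by (simp add: defect_def u'_def)
  qed
  have rep_s: "rep s S = u' S" if "S \<subseteq> N" for S
  proof -
    have "rep s S = u' (lift (proj S))"
      using that proj_subset by (simp add: rep_eq_proj s_def)
    moreover have "u' (lift (proj S)) = u' S"
    \<comment> \<open>Projecting and lifting back either fixes \<open>S\<close> or removes a lone
      \<open>x\<close> or \<open>y\<close>, which \<open>u'\<close> does not see.\<close>
    proof (cases "{x, y} \<subseteq> S \<or> {x, y} \<inter> S = {}")
      case True
      then have "lift (proj S) = S" using that by (auto simp: lift_def proj_def N_eq)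
      then show ?thesis by simp
    next
      case False
      then obtain t where t: "t \<in> {x, y}" "{x, y} \<inter> S = {t}" by blast
      have "proj S = S \<inter> L" using False by (auto simp: proj_def)
      then have "lift (proj S) = S \<inter> L" by (auto simp: lift_def)
      moreover have "insert t (S \<inter> L) = S" using t that by (auto simp: N_eq)
      ultimately show ?thesis using drop[of "S \<inter> L" t] t(1) by simp
    qed
    ultimately show ?thesis by simp
  qed
  show ?thesis
  proof (rule that)
    show "s \<in> set_functions M" by (simp add: s_def)
    \<comment> \<open>Flatness of \<open>r\<close> enters here: tightness of this pair for
      \<open>u\<close> says that \<open>u'\<close> agrees on \<open>{x, y}\<close> and the empty
      set.\<close>
    have "defect (rep r) {x} {y} = 0"
      using x_neq_y rz by (simp add: defect_def rep_eq_proj proj_def insert_commute)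
    then have "defect u {x} {y} = 0"
      using tight by (simp add: inherits_tightness_def)
    then show "s {z} = s {}"
      using x_neq_y z_in by (simp add: s_def u'_def lift_def defect_def w_def insert_commute)
    fix A B assume AB: "A \<subseteq> N" "B \<subseteq> N"
    then have "A \<union> B \<subseteq> N" "A \<inter> B \<subseteq> N" by auto
    then have "defect (rep s) A B = defect u' A B" using AB by (simp add: defect_def rep_s)
    also have "\<dots> = defect u A B"
      using AB fin by (simp add: u'_def defect_diff defect_sum)
    finally show "defect (rep s) A B = defect u A B" .
  qed
qed

text \<open>The subtracted term is modular, so no defect changes while the values at
  \<open>{z}\<close> and \<open>{}\<close> become equal. This makes an arbitrary supermodular
  function on \<open>M\<close> fit for replication.\<close>

definition flatten :: "('a set \<Rightarrow> real) \<Rightarrow> 'a set \<Rightarrow> real" where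
  "flatten s = (\<lambda>A\<in>Pow M. s A - (if z \<in> A then s {z} - s {} else 0))"

lemma flatten_in_set_functions [simp]: "flatten s \<in> set_functions M"
  by (simp add: flatten_def)

lemma flatten_z: "flatten s {z} = flatten s {}"
  using z_in by (simp add: flatten_def)

lemma defect_flatten: "A \<subseteq> M \<Longrightarrow> B \<subseteq> M \<Longrightarrow> defect (flatten s) A B = defect s A B"
  unfolding flatten_def by (simp only: defect_restrict) (simp add: defect_def)

lemma supermodular_flatten: "s \<in> supermodular_functions M \<Longrightarrow> flatten s \<in> supermodular_functions M"
  by (simp add: supermodular_iff_defect defect_flatten)

lemma modular_flatten_iff:
  "s \<in> set_functions M \<Longrightarrow> flatten s \<in> modular_functions M \<longleftrightarrow> s \<in> modular_functions M"
  by (simp add: modular_iff_defect defect_flatten)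

lemma inherits_tightness_flatten:
  "inherits_tightness M r (flatten s) \<longleftrightarrow> inherits_tightness M r s"
  "inherits_tightness M (flatten s) r \<longleftrightarrow> inherits_tightness M s r"
  by (auto simp: inherits_tightness_def defect_flatten)

text \<open>Competitors are translated in both directions: from \<open>M\<close> to \<open>N\<close>
  by flattening and replicating, from \<open>N\<close> to \<open>M\<close> by
  \<open>replication_up_to_modular\<close>. Both translations respect modularity and
  tightness.\<close>

lemma extreme_rep_iff:
  assumes r: "r \<in> set_functions M" and rz: "r {z} = r {}"
  shows "extreme N (rep r) \<longleftrightarrow> extreme M r"
proof
  assume "extreme N (rep r)"
  then have K: "r \<in> supermodular_functions M" and nL: "r \<notin> modular_functions M"
    and ext: "\<And>u. u \<in> supermodular_functions N \<Longrightarrow> inherits_tightness N (rep r) u \<Longrightarrow>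
      u \<in> modular_functions N \<or> inherits_tightness N u (rep r)"
    using r rz by (auto simp: extreme_iff_tightness finite_N supermodular_rep_iff modular_rep_iff)
  have "s \<in> modular_functions M \<or> inherits_tightness M s r"
    if s: "s \<in> supermodular_functions M" "inherits_tightness M r s" for s
  proof -
    have sM: "s \<in> set_functions M" using s by (simp add: supermodular_iff_defect)
    have fK: "flatten s \<in> supermodular_functions M" using s supermodular_flatten by simp
    then have "rep (flatten s) \<in> supermodular_functions N"
      by (simp add: supermodular_rep_iff flatten_z)
    moreover have "inherits_tightness N (rep r) (rep (flatten s))"
      using s K by (simp add: inherits_tightness_rep_iff rz flatten_z inherits_tightness_flatten)
    ultimately have "rep (flatten s) \<in> modular_functions N
        \<or> inherits_tightness N (rep (flatten s)) (rep r)"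
      by (rule ext)
    then show ?thesis
      using fK by (simp add: modular_rep_iff flatten_z modular_flatten_iff sM
          inherits_tightness_rep_iff rz inherits_tightness_flatten)
  qed
  then show "extreme M r" using K nL by (simp add: extreme_iff_tightness finite_M)
next
  assume "extreme M r"
  then have K: "r \<in> supermodular_functions M" and nL: "r \<notin> modular_functions M"
    and ext: "\<And>s. s \<in> supermodular_functions M \<Longrightarrow> inherits_tightness M r s \<Longrightarrow>
      s \<in> modular_functions M \<or> inherits_tightness M s r"
    by (auto simp: extreme_iff_tightness finite_M)
  have "u \<in> modular_functions N \<or> inherits_tightness N u (rep r)"
    if u: "u \<in> supermodular_functions N" and tight: "inherits_tightness N (rep r) u" for u
  proof -
    have uN: "u \<in> set_functions N" using u by (simp add: supermodular_iff_defect)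
    obtain s where s: "s \<in> set_functions M" "s {z} = s {}"
      and def_s: "\<And>A B. A \<subseteq> N \<Longrightarrow> B \<subseteq> N \<Longrightarrow> defect (rep s) A B = defect u A B"
      using replication_up_to_modular[OF tight rz] by metis
    have "rep s \<in> supermodular_functions N"
      using u by (simp add: supermodular_iff_defect def_s)
    then have sK: "s \<in> supermodular_functions M" using s by (simp add: supermodular_rep_iff)
    have "inherits_tightness N (rep r) (rep s)"
      using tight by (simp add: inherits_tightness_def def_s)
    then have "inherits_tightness M r s"
      using K rz s by (simp add: inherits_tightness_rep_iff)
    then have "s \<in> modular_functions M \<or> inherits_tightness M s r" by (rule ext[OF sK])
    then have "rep s \<in> modular_functions N \<or> inherits_tightness N (rep s) (rep r)"
      using s sK rz by (simp add: modular_rep_iff inherits_tightness_rep_iff)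
    then show ?thesis
      using uN by (simp add: modular_iff_defect inherits_tightness_def def_s)
  qed
  then show "extreme N (rep r)"
    using K nL r rz
    by (simp add: extreme_iff_tightness finite_N supermodular_rep_iff modular_rep_iff)
qed

section \<open>Quantitative equivalence and the case of unequal values at \<open>{z}\<close> and
  \<open>{}\<close>\<close>

text \<open>Replication is linear, and \<open>r\<close> differs from its standardization by a
  constant plus a sum over elements. This difference is modular with equal values at
  \<open>{z}\<close> and \<open>{}\<close>, so its replication is modular.\<close>

lemma quant_equiv_rep_lower_standardization:
  assumes "r {z} = r {}"
  shows "quant_equiv N (rep r) (rep (lower_standardization M r))"
proof -
  define d where "d = (\<lambda>A\<in>Pow M. r A - lower_standardization M r A)"
  have d_eq: "d A = r {} - (\<Sum>i\<in>A. r {} - r {i})" if "A \<subseteq> M" for A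
    using that by (simp add: d_def lower_standardization_def)
  have "defect d A B = 0" if "A \<subseteq> M" "B \<subseteq> M" for A B
  proof -
    have sub: "A \<union> B \<subseteq> M" "A \<inter> B \<subseteq> M" using that by auto
    have "finite A" "finite B" using that finite_M finite_subset by blast+
    then have "defect (sum (\<lambda>i. r {} - r {i})) A B = 0" by (rule defect_sum)
    then show ?thesis using that sub by (simp add: defect_def d_eq)
  qed
  then have "d \<in> modular_functions M" by (simp add: modular_iff_defect d_def)
  moreover have "d {z} = d {}" using assms z_in by (simp add: d_eq)
  ultimately have "rep d \<in> modular_functions N" by (simp add: modular_rep_iff d_def)
  moreover have "rep d = (\<lambda>S\<in>Pow N. rep r S - rep (lower_standardization M r) S)"
    using proj_subset by (intro set_functions_eqI[of _ N]) (simp_all add: rep_eq_proj d_def)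
  ultimately show ?thesis by (simp add: quant_equiv_def)
qed

text \<open>The projection of \<open>S\<close> contains \<open>z\<close> exactly when
  \<open>S\<close> contains \<open>x\<close> and \<open>y\<close>, so the modular term removed by
  \<open>flatten\<close> replicates to a multiple of an indicator.\<close>

lemma rep_eq_rep_flatten:
  assumes "S \<subseteq> N"
  shows "rep r S = rep (flatten r) S + (r {z} - r {}) * superset_indicator N {x, y} S"
proof -
  have "z \<in> proj S \<longleftrightarrow> {x, y} \<subseteq> S" by (auto simp: proj_def)
  then show ?thesis
    using assms proj_subset by (simp add: rep_eq_proj flatten_def superset_indicator_def)
qed

lemma defect_superset_indicator_nonneg:
  assumes "A \<subseteq> N" "B \<subseteq> N"
  shows "0 \<le> defect (superset_indicator N {x, y}) A B"
proof -
  have "A \<union> B \<subseteq> N" "A \<inter> B \<subseteq> N" using assms by auto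
  then show ?thesis using assms by (auto simp: defect_def superset_indicator_def)
qed

text \<open>The flattened replication is a supermodular summand of \<open>rep r\<close> and thus
  inherits its tightness. Extremality makes it modular unless it has the same tight pairs as
  \<open>rep r\<close>.\<close>

lemma extreme_rep_nonflat:
  assumes r: "r \<in> set_functions M" and ext: "extreme N (rep r)" and rz: "r {z} \<noteq> r {}"
  shows "r {z} > r {} \<and> r \<in> modular_functions M \<and>
    quant_equiv N (rep r) (\<lambda>S\<in>Pow N. (r {z} - r {}) * superset_indicator N {x, y} S)"
proof -
  let ?c = "r {z} - r {}" and ?i = "superset_indicator N {x, y}"
  have "rep r \<in> supermodular_functions N" using ext by (simp add: extreme_def)
  then have K: "r \<in> supermodular_functions M" and c: "r {z} > r {}"
    using r rz by (auto simp: supermodular_rep_iff)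
  have fK: "rep (flatten r) \<in> supermodular_functions N"
    using K by (simp add: supermodular_rep_iff flatten_z supermodular_flatten)
  have eq: "defect (rep r) A B = defect (rep (flatten r)) A B + ?c * defect ?i A B"
    if "A \<subseteq> N" "B \<subseteq> N" for A B
  proof -
    have "A \<union> B \<subseteq> N" "A \<inter> B \<subseteq> N" using that by auto
    then show ?thesis
      using that by (simp add: defect_def rep_eq_rep_flatten[where r = r] algebra_simps)
  qed
  have "defect (rep (flatten r)) A B = 0" if "A \<subseteq> N" "B \<subseteq> N" "defect (rep r) A B = 0" for A B
  proof -
    have "0 \<le> defect (rep (flatten r)) A B" using fK that by (simp add: supermodular_iff_defect)
    moreover have "0 \<le> ?c * defect ?i A B"
      using defect_superset_indicator_nonneg[OF that(1,2)] c by simp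
    ultimately show ?thesis using eq[OF that(1,2)] that(3) by linarith
  qed
  then have "inherits_tightness N (rep r) (rep (flatten r))" by (simp add: inherits_tightness_def)
  then have "rep (flatten r) \<in> modular_functions N
      \<or> inherits_tightness N (rep (flatten r)) (rep r)"
    using ext fK by (simp add: extreme_iff_tightness finite_N)
  \<comment> \<open>The pair \<open>{x}\<close>, \<open>{y}\<close> tells them apart: it is tight
    after flattening, but its defect for \<open>rep r\<close> is \<open>r {z} - r {}\<close>, which
    is nonzero.\<close>
  moreover have "\<not> inherits_tightness N (rep (flatten r)) (rep r)"
  proof
    assume inh: "inherits_tightness N (rep (flatten r)) (rep r)"
    have xy: "defect (rep t) {x} {y} = t {z} - t {}" for t
      using x_neq_y by (simp add: defect_def rep_eq_proj proj_def insert_commute)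
    have "defect (rep (flatten r)) {x} {y} = 0" using xy[of "flatten r"] flatten_z by simp
    then have "defect (rep r) {x} {y} = 0" using inh by (simp add: inherits_tightness_def)
    then show False using xy[of r] rz by simp
  qed
  ultimately have mod: "rep (flatten r) \<in> modular_functions N" by blast
  then have "r \<in> modular_functions M" using r by (simp add: modular_rep_iff modular_flatten_iff)
  moreover have "rep (flatten r) =
      (\<lambda>S\<in>Pow N. rep r S - (\<lambda>S\<in>Pow N. ?c * ?i S) S)"
    by (intro set_functions_eqI[of _ N]) (simp_all add: rep_eq_rep_flatten[where r = r])
  ultimately show ?thesis using c mod by (simp add: quant_equiv_def)
qed

section \<open>Standardized functions and the induced independency model\<close>

lemma lower_standardized_rep:
  assumes "r \<in> lower_standardized M"
  shows "rep r \<in> lower_standardized N"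
proof -
  have r: "r \<in> supermodular_functions M" "r {} = 0" "\<And>i. i \<in> M \<Longrightarrow> r {i} = 0"
    using assms by (auto simp: lower_standardized_def)
  have "r \<in> set_functions M" using r(1) by (simp add: supermodular_iff_defect)
  then have "rep r \<in> supermodular_functions N" using r z_in by (simp add: supermodular_rep_iff)
  moreover have "rep r {i} = 0" if "i \<in> N" for i
    using that x_neq_y r by (cases "i \<in> L") (auto simp: rep_eq_proj proj_def M_eq)
  moreover have "rep r {} = 0" using r by (simp add: rep_eq_proj proj_def)
  ultimately show ?thesis by (simp add: lower_standardized_def)
qed

lemma induced_model_rep_iff:
  assumes "(a, b, C) \<in> triplets N"
  shows "(a, b, C) \<in> induced_model N (rep r) \<longleftrightarrow>
    r (proj (insert a (insert b C))) + r (proj C) - r (proj (insert a C)) - r (proj (insert b C)) = 0"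
proof -
  have "a \<in> N" "b \<in> N" "C \<subseteq> N" using assms by (auto simp: triplets_def)
  then show ?thesis
    using assms by (simp add: induced_model_def cond_indep_def rep_eq_proj insert_commute)
qed

text \<open>The cases differ in which of the four sets built from \<open>a\<close>,
  \<open>b\<close>, \<open>C\<close> contain both \<open>x\<close> and \<open>y\<close>, so that
  \<open>z\<close> enters their projections: none of them, all of them, the largest and one
  intermediate set, or the largest alone.\<close>

lemma induced_model_rep_cases:
  assumes abC: "(a, b, C) \<in> triplets N"
  shows "{x, y} - ({a} \<union> {b} \<union> C) \<noteq> {} \<Longrightarrow>
      (a, b, C) \<in> induced_model N (rep r) \<longleftrightarrow> cond_indep r ({a} \<inter> L) ({b} \<inter> L) (C \<inter> L)"
    and "{x, y} \<subseteq> C \<Longrightarrow>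
      (a, b, C) \<in> induced_model N (rep r) \<longleftrightarrow> cond_indep r {a} {b} ({z} \<union> (C \<inter> L))"
    and "card ({x, y} \<inter> C) = 1 \<Longrightarrow> {x, y} \<subseteq> {a} \<union> {b} \<union> C \<Longrightarrow>
      (a, b, C) \<in> induced_model N (rep r) \<longleftrightarrow> cond_indep r {z} ({a, b} \<inter> L) (C \<inter> L)"
    and "{x, y} = {a, b} \<Longrightarrow>
      (a, b, C) \<in> induced_model N (rep r) \<longleftrightarrow> r ({z} \<union> C) = r C"
proof -
  have t: "a \<in> N" "b \<in> N" "a \<noteq> b" "C \<subseteq> N" "a \<notin> C" "b \<notin> C"
    using abC by (auto simp: triplets_def)
  note iff = induced_model_rep_iff[OF abC]
  show "(a, b, C) \<in> induced_model N (rep r) \<longleftrightarrow> cond_indep r ({a} \<inter> L) ({b} \<inter> L) (C \<inter> L)"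
    if "{x, y} - ({a} \<union> {b} \<union> C) \<noteq> {}"
  proof -
    have "proj (insert a (insert b C)) = {a} \<inter> L \<union> {b} \<inter> L \<union> C \<inter> L" "proj C = C \<inter> L"
      "proj (insert a C) = {a} \<inter> L \<union> C \<inter> L" "proj (insert b C) = {b} \<inter> L \<union> C \<inter> L"
      using that by (auto simp: proj_def)
    then show ?thesis by (simp add: iff cond_indep_def)
  qed
  show "(a, b, C) \<in> induced_model N (rep r) \<longleftrightarrow> cond_indep r {a} {b} ({z} \<union> (C \<inter> L))"
    if xyC: "{x, y} \<subseteq> C"
  proof -
    have "a \<in> L" "b \<in> L" using t xyC by (auto simp: N_eq)
    then have "proj (insert a (insert b C)) = {a} \<union> {b} \<union> ({z} \<union> C \<inter> L)"
      "proj C = {z} \<union> C \<inter> L" "proj (insert a C) = {a} \<union> ({z} \<union> C \<inter> L)"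
      "proj (insert b C) = {b} \<union> ({z} \<union> C \<inter> L)"
      using xyC by (auto simp: proj_def)
    then show ?thesis by (simp only: iff cond_indep_def)
  qed
  show "(a, b, C) \<in> induced_model N (rep r) \<longleftrightarrow> cond_indep r {z} ({a, b} \<inter> L) (C \<inter> L)"
    if card: "card ({x, y} \<inter> C) = 1" and sub: "{x, y} \<subseteq> {a} \<union> {b} \<union> C"
  proof -
    have xyC: "x \<in> C \<longleftrightarrow> y \<notin> C"
      using card x_neq_y by (cases "x \<in> C"; cases "y \<in> C") auto
    \<comment> \<open>One of \<open>x\<close>, \<open>y\<close> is in \<open>C\<close>, so the other
      is \<open>a\<close> or \<open>b\<close>, and the remaining element lies in \<open>L\<close>.
      It is then the only element of \<open>{a, b} \<inter> L\<close>.\<close>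
    consider "a \<in> {x, y}" "b \<in> L" | "b \<in> {x, y}" "a \<in> L"
      using t sub xyC by (auto simp: N_eq)
    then show ?thesis
    proof cases
      case 1
      then have "{x, y} \<subseteq> insert a C" "\<not> {x, y} \<subseteq> insert b C" "\<not> {x, y} \<subseteq> C" "a \<notin> L"
        using t sub xyC by auto
      then have "proj (insert a (insert b C)) = {z} \<union> {a, b} \<inter> L \<union> C \<inter> L" "proj C = C \<inter> L"
        "proj (insert a C) = {z} \<union> C \<inter> L" "proj (insert b C) = {a, b} \<inter> L \<union> C \<inter> L"
        using 1 by (auto simp: proj_def)
      then show ?thesis by (simp only: iff cond_indep_def)
    next
      case 2
      then have "{x, y} \<subseteq> insert b C" "\<not> {x, y} \<subseteq> insert a C" "\<not> {x, y} \<subseteq> C" "b \<notin> L"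
        using t sub xyC by auto
      then have "proj (insert a (insert b C)) = {z} \<union> {a, b} \<inter> L \<union> C \<inter> L" "proj C = C \<inter> L"
        "proj (insert b C) = {z} \<union> C \<inter> L" "proj (insert a C) = {a, b} \<inter> L \<union> C \<inter> L"
        using 2 by (auto simp: proj_def)
      then show ?thesis by (simp add: iff cond_indep_def algebra_simps)
    qed
  qed
  show "(a, b, C) \<in> induced_model N (rep r) \<longleftrightarrow> r ({z} \<union> C) = r C" if ab: "{x, y} = {a, b}"
  proof -
    have "C \<subseteq> L" using t ab by (auto simp: N_eq)
    moreover have "a \<in> {x, y}" "b \<in> {x, y}" using ab by auto
    ultimately have "proj (insert a (insert b C)) = {z} \<union> C" "proj C = C"
      "proj (insert a C) = C" "proj (insert b C) = C"
      using t x_neq_y by (auto simp: proj_def)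
    then show ?thesis by (simp add: iff)
  qed
qed

end

section \<open>The three assertions combined\<close>

theorem mainTheorem9:
  fixes N M L :: "'a set" and x y z :: 'a and r :: "'a set \<Rightarrow> real"
  assumes "finite N" and "finite M"
    and "z \<in> M" and "L = M - {z}" and "L \<subset> N"
    and "N - L = {x, y}" and "x \<noteq> y"
    and "r \<in> set_functions M"
  shows
    "((lower_replication N L z r \<in> supermodular_functions N \<longleftrightarrow>
         r \<in> supermodular_functions M \<and> r {z} \<ge> r {}) \<and>
      (\<forall>a b C. (a, b, C) \<in> triplets N \<longrightarrow>
         ({x, y} - ({a} \<union> {b} \<union> C) \<noteq> {} \<longrightarrow>
            ((a, b, C) \<in> induced_model N (lower_replication N L z r) \<longleftrightarrow>
             cond_indep r ({a} \<inter> L) ({b} \<inter> L) (C \<inter> L))) \<and>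
         ({x, y} \<subseteq> C \<longrightarrow>
            ((a, b, C) \<in> induced_model N (lower_replication N L z r) \<longleftrightarrow>
             cond_indep r {a} {b} ({z} \<union> (C \<inter> L)))) \<and>
         (card ({x, y} \<inter> C) = 1 \<and> {x, y} \<subseteq> {a} \<union> {b} \<union> C \<longrightarrow>
            ((a, b, C) \<in> induced_model N (lower_replication N L z r) \<longleftrightarrow>
             cond_indep r {z} ({a, b} \<inter> L) (C \<inter> L))) \<and>
         ({x, y} = {a, b} \<longrightarrow>
            ((a, b, C) \<in> induced_model N (lower_replication N L z r) \<longleftrightarrow>
             r ({z} \<union> C) = r C))))
     \<and>
     ((r \<in> lower_standardized M \<longrightarrow> lower_replication N L z r \<in> lower_standardized N) \<and>
      (r \<in> lower_standardized M \<longrightarrow>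
         (extreme M r \<longleftrightarrow> extreme N (lower_replication N L z r))))
     \<and>
     ((extreme M r \<and> r {z} = r {} \<longrightarrow>
         extreme N (lower_replication N L z r) \<and>
         quant_equiv N (lower_replication N L z r)
           (lower_replication N L z (lower_standardization M r))) \<and>
      (extreme N (lower_replication N L z r) \<longrightarrow>
         (extreme M r \<and> r {z} = r {}) \<or>
         (r {z} > r {} \<and> r \<in> modular_functions M \<and>
          quant_equiv N (lower_replication N L z r)
            (\<lambda>S\<in>Pow N. (r {z} - r {}) * superset_indicator N {x, y} S))))"
proof -
  interpret replication N M L x y z by unfold_locales (fact assms)+
  show ?thesis
  proof (intro conjI)
    show "rep r \<in> supermodular_functions N \<longleftrightarrow> r \<in> supermodular_functions M \<and> r {z} \<ge> r {}"
      using supermodular_rep_iff[OF assms(8)] .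
    show "r \<in> lower_standardized M \<longrightarrow> rep r \<in> lower_standardized N"
      using lower_standardized_rep by blast
    \<comment> \<open>Standardization gives \<open>r {z} = 0 = r {}\<close>, so the equivalence for
      flat functions applies.\<close>
    show "r \<in> lower_standardized M \<longrightarrow> (extreme M r \<longleftrightarrow> extreme N (rep r))"
      using extreme_rep_iff[OF assms(8)] z_in by (simp add: lower_standardized_def)
    show "extreme M r \<and> r {z} = r {} \<longrightarrow>
        extreme N (rep r) \<and> quant_equiv N (rep r) (rep (lower_standardization M r))"
      using extreme_rep_iff[OF assms(8)] quant_equiv_rep_lower_standardization by blast
    show "extreme N (rep r) \<longrightarrow>
        (extreme M r \<and> r {z} = r {}) \<or>
        (r {z} > r {} \<and> r \<in> modular_functions M \<and>
         quant_equiv N (rep r) (\<lambda>S\<in>Pow N. (r {z} - r {}) * superset_indicator N {x, y} S))"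
      using extreme_rep_iff[OF assms(8)] extreme_rep_nonflat[OF assms(8)] by blast
  qed (intro allI impI conjI; (elim conjE)?; rule induced_model_rep_cases; assumption)
qed

end
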